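(* Consider mutually independent binary-valued processes $\{l^{(1)}(t)\in\{0,1\}\}_{t\in\mathbb{N}_0}$ and $\{l^{(2)}(t)\in\{0,1\}\}_{t\in\mathbb{N}_0}$ that satisfy $l^{(1)}\in\Gamma_{p_0^{(1)},p_1^{(1)}}$ and $l^{(2)}\in\Lambda_{\rho^{(2)}}$, where $p_0^{(1)},p_1^{(1)},\rho^{(2)}\in[0,1]$ and $p_1^{(1)}+p_0^{(1)}\rho^{(2)}<1$. Then the process $\{\tilde l(t)\in\{0,1\}\}_{t\in\mathbb{N}_0}$ defined by $$\tilde l(t)=l^{(1)}(t)\vee l^{(2)}(t),\quad t\in\mathbb{N}_0,$$ satisfies $\tilde l\in\Lambda_{\tilde\rho}$ for all $\tilde\rho\in(p_1^{(1)}+p_0^{(1)}\rho^{(2)},1]$.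
   Context: All processes are defined on a common probability space $(\Omega,\mathcal{F},\mathbb{P})$ with filtration $\{\mathcal{F}_t\}_{t\in\mathbb{N}_0}$. $\vee$ denotes the or-operation on binary numbers. Class $\Lambda_\rho$: for $\rho\in[0,1]$, $\Lambda_\rho$ is the class of binary-valued processes $l=\{l(t)\in\{0,1\}\}_{t\in\mathbb{N}_0}$ such that $\sum_{k=1}^{\infty}\mathbb{P}[\sum_{t=0}^{k-1}l(t)>\rho k]<\infty$. Hidden Markov models: a binary-valued process $\{l(t)\in\{0,1\}\}_{t\in\mathbb{N}_0}$ is the output process of a time-inhomogeneous hidden Markov model if $l(t)=h^l(\theta^l(t))$, $t\in\mathbb{N}_0$, where $h^l\colon\Theta^l\to\{0,1\}$ is a function on a finite set $\Theta^l$ and $\{\theta^l(t)\in\Theta^l\}_{t\in\mathbb{N}_0}$ is an $\mathcal{F}_t$-adapted, finite-state, time-inhomogeneous Markov chain with initial distribution $\vartheta^l_q\in[0,1]$, $q\in\Theta^l$, and time-varying transition probability functions $p^l_{q,r}\colon\mathbb{N}_0\to[0,1]$, $q,r\in\Theta^l$ (so $\sum_{r\in\Theta^l}p^l_{q,r}(t)=1$), satisfying $\mathbb{P}[\theta^l(0)=q]=\vartheta^l_q$ and $\mathbb{P}[\theta^l(t+1)=r\mid\theta^l(t)=q]=p^l_{q,r}(t)$. Put $\Theta^l_0\triangleq\{r\in\Theta^l\colon h^l(r)=0\}$ and $\Theta^l_1\triangleq\{r\in\Theta^l\colon h^l(r)=1\}$. Class $\Gamma_{p_0,p_1}$: for $p_0,p_1\in[0,1]$,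 $\Gamma_{p_0,p_1}$ is the class of output processes $l$ of time-inhomogeneous hidden Markov models such that $\sum_{r\in\Theta^l_0}p^l_{q,r}(t)\le p_0$ and $\sum_{r\in\Theta^l_1}p^l_{q,r}(t)\le p_1$ for all $q\in\Theta^l$, $t\in\mathbb{N}_0$. *)

theory Defs
  imports "HOL-Probability.Probability"
begin

unbundle bit_operations_syntax

definition binary_process :: "'a measure \<Rightarrow> (nat \<Rightarrow> 'a \<Rightarrow> nat) \<Rightarrow> bool" where
  "binary_process M l \<longleftrightarrow> (\<forall>t. l t \<in> M \<rightarrow>\<^sub>M count_space {0, 1})"

definition Lambda_processes :: "'a measure \<Rightarrow> real \<Rightarrow> (nat \<Rightarrow> 'a \<Rightarrow> nat) set" where
  "Lambda_processes M \<rho> = {l. binary_process M l \<and>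
     (\<lambda>k. \<P>(\<omega> in M. real (\<Sum>t<k. l t \<omega>) > \<rho> * real k)) summable_on {1::nat..}}"

text \<open>
  A filtration on the probability space \<open>M\<close>: the library locale does not itself
  require \<open>F t\<close> to consist of events of \<open>M\<close>.
\<close>

definition prob_filtration :: "'a measure \<Rightarrow> (nat \<Rightarrow> 'a measure) \<Rightarrow> bool" where
  "prob_filtration M F \<longleftrightarrow> filtration (space M) F \<and> (\<forall>t. subalgebra M (F t))"

text \<open>
  Conditional probabilities are constrained only when the conditioning event has positive
  probability: the library's \<open>cond_prob\<close> is \<open>0\<close> on null conditioning events, which
  would contradict \<open>(\<Sum>r\<in>\<Theta>. p q r t) = 1\<close> at states that are not reached at time \<open>t\<close>.
  The Markov property refers to the history of the chain itself, so for an adapted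
  chain it is implied by the Markov property relative to \<open>F\<close>.
\<close>

definition markov_chain ::
  "'a measure \<Rightarrow> (nat \<Rightarrow> 'a measure) \<Rightarrow> 's set \<Rightarrow> ('s \<Rightarrow> real) \<Rightarrow>
   ('s \<Rightarrow> 's \<Rightarrow> nat \<Rightarrow> real) \<Rightarrow> (nat \<Rightarrow> 'a \<Rightarrow> 's) \<Rightarrow> bool" where
  "markov_chain M F \<Theta> \<theta>0 p \<theta> \<longleftrightarrow>
     finite \<Theta> \<and>
     (\<forall>q\<in>\<Theta>. \<theta>0 q \<in> {0..1}) \<and> (\<Sum>q\<in>\<Theta>. \<theta>0 q) = 1 \<and>
     (\<forall>q\<in>\<Theta>. \<forall>r\<in>\<Theta>. \<forall>t. p q r t \<in> {0..1}) \<and>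
     (\<forall>q\<in>\<Theta>. \<forall>t. (\<Sum>r\<in>\<Theta>. p q r t) = 1) \<and>
     (\<forall>t. \<theta> t \<in> F t \<rightarrow>\<^sub>M count_space \<Theta>) \<and>
     (\<forall>q\<in>\<Theta>. \<P>(\<omega> in M. \<theta> 0 \<omega> = q) = \<theta>0 q) \<and>
     (\<forall>t. \<forall>x\<in>{..t} \<rightarrow> \<Theta>. \<forall>r\<in>\<Theta>. \<P>(\<omega> in M. \<forall>s\<le>t. \<theta> s \<omega> = x s) > 0 \<longrightarrow>
        \<P>(\<omega> in M. \<theta> (Suc t) \<omega> = r \<bar> \<forall>s\<le>t. \<theta> s \<omega> = x s) =
        \<P>(\<omega> in M. \<theta> (Suc t) \<omega> = r \<bar> \<theta> t \<omega> = x t)) \<and>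
     (\<forall>t. \<forall>q\<in>\<Theta>. \<forall>r\<in>\<Theta>. \<P>(\<omega> in M. \<theta> t \<omega> = q) > 0 \<longrightarrow>
        \<P>(\<omega> in M. \<theta> (Suc t) \<omega> = r \<bar> \<theta> t \<omega> = q) = p q r t)"

definition hmm_output ::
  "'a measure \<Rightarrow> (nat \<Rightarrow> 'a measure) \<Rightarrow> 's set \<Rightarrow> ('s \<Rightarrow> nat) \<Rightarrow> ('s \<Rightarrow> real) \<Rightarrow>
   ('s \<Rightarrow> 's \<Rightarrow> nat \<Rightarrow> real) \<Rightarrow> (nat \<Rightarrow> 'a \<Rightarrow> 's) \<Rightarrow> (nat \<Rightarrow> 'a \<Rightarrow> nat) \<Rightarrow> bool" where
  "hmm_output M F \<Theta> h \<theta>0 p \<theta> l \<longleftrightarrow>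
     binary_process M l \<and> h \<in> \<Theta> \<rightarrow> {0, 1} \<and> markov_chain M F \<Theta> \<theta>0 p \<theta> \<and>
     (\<forall>t. \<forall>\<omega>\<in>space M. l t \<omega> = h (\<theta> t \<omega>))"

text \<open>
  HOL cannot quantify existentially over the type of hidden states, so that type is a
  parameter of the class; statements polymorphic in \<open>'s\<close> cover all finite state sets.
\<close>

definition Gamma_processes ::
  "'s itself \<Rightarrow> 'a measure \<Rightarrow> (nat \<Rightarrow> 'a measure) \<Rightarrow> real \<Rightarrow> real \<Rightarrow> (nat \<Rightarrow> 'a \<Rightarrow> nat) set" where
  "Gamma_processes (_ :: 's itself) M F p0 p1 =
     {l. \<exists>(\<Theta> :: 's set) h \<theta>0 p \<theta>. hmm_output M F \<Theta> h \<theta>0 p \<theta> l \<and>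
        (\<forall>q\<in>\<Theta>. \<forall>t. (\<Sum>r\<in>{r\<in>\<Theta>. h r = 0}. p q r t) \<le> p0 \<and>
                   (\<Sum>r\<in>{r\<in>\<Theta>. h r = 1}. p q r t) \<le> p1)}"

text \<open>Independence of whole processes, i.e. of the sigma-algebras they generate.\<close>

definition indep_binary_processes ::
  "'a measure \<Rightarrow> (nat \<Rightarrow> 'a \<Rightarrow> nat) \<Rightarrow> (nat \<Rightarrow> 'a \<Rightarrow> nat) \<Rightarrow> bool" where
  "indep_binary_processes M l1 l2 \<longleftrightarrow>
     prob_space.indep_var M
       (\<Pi>\<^sub>M t\<in>UNIV. count_space {0, 1}) (\<lambda>\<omega> t. l1 t \<omega>)
       (\<Pi>\<^sub>M t\<in>UNIV. count_space {0, 1}) (\<lambda>\<omega> t. l2 t \<omega>)"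

end

theory Submission
  imports Defs
begin

text \<open>
  Each row of the transition matrix sums to \<open>1\<close>, so \<open>p0 + p1 \<ge> 1\<close> and
  \<open>m = p1 + (1 - p1) * \<rho> \<le> p1 + p0 * \<rho>\<close>; only the bound \<open>p1\<close> on the probability of
  jumping into an output \<open>1\<close> is then needed. Fix a path \<open>v\<close> of the second process with at most
  \<open>\<rho> k\<close> ones before time \<open>k\<close>. Conditioning on the history of the chain, each step multiplies the
  exponential moment of \<open>\<Sum>t<k. l1 t OR v t\<close> by at most \<open>exp (b * (p1 + (1 - p1) * v t))\<close>, where
  \<open>b = u + u\<^sup>2\<close> and \<open>0 \<le> u \<le> 1\<close>, so Chernoff's bound with \<open>u = (\<rho>' - m) / 2\<close> decays
  geometrically in \<open>k\<close>. By independence this bound, being uniform in \<open>v\<close>, survives averaging over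
  the paths of \<open>l2\<close>, and the paths with more than \<open>\<rho> k\<close> ones are summable by assumption.
\<close>

section \<open>Random variables with finitely many values\<close>

text \<open>Reduces an integral to finitely many values of \<open>X\<close>, so that a one-step
  estimate can be applied history by history. The factor \<open>indicator E\<close> lets one formula
  serve both for the event of a next output one and for \<open>E = space M\<close>.\<close>

lemma (in prob_space) integral_finite_range:
  fixes f :: "'b \<Rightarrow> real"
  assumes S: "finite S" and X: "X \<in> M \<rightarrow>\<^sub>M count_space S" and E: "E \<in> events"
  shows "(\<integral>\<omega>. f (X \<omega>) * indicator E \<omega> \<partial>M)
    = (\<Sum>x\<in>S. f x * prob ({\<omega>\<in>space M. X \<omega> = x} \<inter> E))"
proof -
  have ev: "{\<omega>\<in>space M. X \<omega> = x} \<inter> E \<in> events" if "x \<in> S" for x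
  proof -
    have "X -` {x} \<inter> space M \<in> events"
      using X that by (intro measurable_sets[OF X]) auto
    moreover have "X -` {x} \<inter> space M = {\<omega>\<in>space M. X \<omega> = x}"
      by auto
    ultimately show ?thesis
      using E by auto
  qed
  have "(\<integral>\<omega>. f (X \<omega>) * indicator E \<omega> \<partial>M)
    = (\<integral>\<omega>. (\<Sum>x\<in>S. f x * indicator ({\<omega>\<in>space M. X \<omega> = x} \<inter> E) \<omega>) \<partial>M)"
  proof (rule Bochner_Integration.integral_cong[OF refl])
    fix \<omega> assume \<omega>: "\<omega> \<in> space M"
    then have "X \<omega> \<in> S"
      using measurable_space[OF X] by simp
    moreover have "(\<Sum>x\<in>S. f x * indicator ({\<omega>\<in>space M. X \<omega> = x} \<inter> E) \<omega>)
      = (\<Sum>x\<in>S. if X \<omega> = x then f x * indicator E \<omega> else 0)"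
      using \<omega> by (intro sum.cong) (auto simp: indicator_def)
    ultimately show "f (X \<omega>) * indicator E \<omega>
      = (\<Sum>x\<in>S. f x * indicator ({\<omega>\<in>space M. X \<omega> = x} \<inter> E) \<omega>)"
      using S by simp
  qed
  also have "\<dots> = (\<Sum>x\<in>S. f x * prob ({\<omega>\<in>space M. X \<omega> = x} \<inter> E))"
    using ev by (subst Bochner_Integration.integral_sum)
      (auto intro!: integrable_mult_right integrable_real_indicator simp: emeasure_eq_measure)
  finally show ?thesis .
qed

text \<open>Makes the whole history of a chain one finite-valued variable: a finite product of
  finite discrete spaces is again discrete.\<close>

lemma measurable_restrict_count_space_PiE:
  assumes "finite T" and S: "finite S" and X: "\<And>t. t \<in> T \<Longrightarrow> X t \<in> M \<rightarrow>\<^sub>M count_space S"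
  shows "(\<lambda>\<omega>. \<lambda>t\<in>T. X t \<omega>) \<in> M \<rightarrow>\<^sub>M count_space (T \<rightarrow>\<^sub>E S)"
proof -
  have "(\<lambda>\<omega>. \<lambda>t\<in>T. X t \<omega>) \<in> M \<rightarrow>\<^sub>M (\<Pi>\<^sub>M t\<in>T. count_space S)"
    using X by (rule measurable_restrict)
  then show ?thesis
    using assms by (simp add: count_space_PiM_finite countable_finite)
qed

lemma measurable_count_space_mono:
  assumes "f \<in> M \<rightarrow>\<^sub>M count_space A" and "A \<subseteq> B"
  shows "f \<in> M \<rightarrow>\<^sub>M count_space B"
  by (rule measurable_compose[OF assms(1)]) (use assms(2) in \<open>auto simp: measurable_count_space_eq1\<close>)

lemma prob_filtration_measurable:
  assumes "prob_filtration M F" and "X \<in> F t \<rightarrow>\<^sub>M N"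
  shows "X \<in> M \<rightarrow>\<^sub>M N"
  using assms measurable_from_subalg unfolding prob_filtration_def by blast

section \<open>One step of the chain given its history\<close>

text \<open>The Markov property reduces conditioning on the history \<open>x\<close> to conditioning
  on the state \<open>x t\<close>, and the transition probabilities into \<open>R\<close> add up to
  at most \<open>c\<close>. Multiplying by the probability of the history makes the bound true for
  null histories as well.\<close>

lemma (in prob_space) markov_chain_step:
  assumes mc: "markov_chain M F \<Theta> \<theta>0 p \<theta>" and filt: "prob_filtration M F"
    and R: "R \<subseteq> \<Theta>" and x: "x \<in> {..t} \<rightarrow>\<^sub>E \<Theta>"
    and le: "(\<Sum>r\<in>R. p (x t) r t) \<le> c"
  shows "prob ({\<omega>\<in>space M. (\<lambda>s\<in>{..t}. \<theta> s \<omega>) = x} \<inter> {\<omega>\<in>space M. \<theta> (Suc t) \<omega> \<in> R})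
    \<le> c * prob {\<omega>\<in>space M. (\<lambda>s\<in>{..t}. \<theta> s \<omega>) = x}"
proof -
  have fin: "finite \<Theta>" "finite R"
    using mc R by (auto simp: markov_chain_def intro: finite_subset)
  have meas: "\<theta> s \<in> M \<rightarrow>\<^sub>M count_space \<Theta>" for s
    using mc unfolding markov_chain_def by (blast intro: prob_filtration_measurable[OF filt])
  have at: "{\<omega>\<in>space M. \<theta> s \<omega> = r} \<in> events" if "r \<in> \<Theta>" for s r
  proof -
    have "\<theta> s -` {r} \<inter> space M \<in> events"
      using that by (intro measurable_sets[OF meas]) auto
    then show ?thesis
      by (simp add: vimage_def Int_def conj_commute)
  qed
  let ?H = "{\<omega>\<in>space M. \<forall>s\<le>t. \<theta> s \<omega> = x s}"
  \<comment> \<open>Off \<open>{..t}\<close> both the restricted path and the extensional function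
    \<open>x\<close> are \<open>undefined\<close>, so only the times up to \<open>t\<close>
    matter.\<close>
  have H: "{\<omega>\<in>space M. (\<lambda>s\<in>{..t}. \<theta> s \<omega>) = x} = ?H"
  proof (rule Collect_cong, rule conj_cong[OF refl])
    fix \<omega>
    show "(\<lambda>s\<in>{..t}. \<theta> s \<omega>) = x \<longleftrightarrow> (\<forall>s\<le>t. \<theta> s \<omega> = x s)"
      using PiE_arb[OF x] by (auto simp: fun_eq_iff)
  qed
  have xs: "x s \<in> \<Theta>" if "s \<le> t" for s
    using x that by auto
  have Hev: "?H \<in> events"
  proof -
    have "?H = (\<Inter>s\<in>{..t}. {\<omega>\<in>space M. \<theta> s \<omega> = x s})"
      by auto
    then show ?thesis
      using at xs by (auto intro!: sets.finite_INT)
  qed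
  \<comment> \<open>\<open>markov_chain\<close> constrains conditional probabilities only on events
    of positive probability; for a null history both sides vanish.\<close>
  show ?thesis
  proof (cases "prob ?H = 0")
    case True
    have "prob (?H \<inter> {\<omega>\<in>space M. \<theta> (Suc t) \<omega> \<in> R}) \<le> prob ?H"
      by (rule finite_measure_mono[OF Int_lower1 Hev])
    then show ?thesis
      using True unfolding H by (simp add: measure_le_0_iff)
  next
    case False
    then have pos: "prob ?H > 0"
      by (simp add: zero_less_measure_iff)
    \<comment> \<open>The Markov clause needs a history of positive probability, the transition
      clause a current state of positive probability; the second follows because the history
      determines the state.\<close>
    also have "prob ?H \<le> \<P>(\<omega> in M. \<theta> t \<omega> = x t)"
      using at[OF xs[OF order_refl]] by (intro finite_measure_mono) auto
    finally have pos': "\<P>(\<omega> in M. \<theta> t \<omega> = x t) > 0" .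
    have step: "prob (?H \<inter> {\<omega>\<in>space M. \<theta> (Suc t) \<omega> = r}) = p (x t) r t * prob ?H"
      if r: "r \<in> R" for r
    proof -
      have x': "x \<in> {..t} \<rightarrow> \<Theta>"
        using x by auto
      have r': "r \<in> \<Theta>" and xt: "x t \<in> \<Theta>"
        using r R xs[of t] by auto
      have "\<P>(\<omega> in M. \<theta> (Suc t) \<omega> = r \<bar> \<forall>s\<le>t. \<theta> s \<omega> = x s)
        = \<P>(\<omega> in M. \<theta> (Suc t) \<omega> = r \<bar> \<theta> t \<omega> = x t)"
        using mc pos x' r' unfolding markov_chain_def by blast
      also have "\<dots> = p (x t) r t"
        using mc pos' xt r' unfolding markov_chain_def by blast
      finally have "\<P>(\<omega> in M. \<theta> (Suc t) \<omega> = r \<bar> \<forall>s\<le>t. \<theta> s \<omega> = x s) = p (x t) r t" .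
      moreover have "{\<omega>\<in>space M. \<theta> (Suc t) \<omega> = r \<and> (\<forall>s\<le>t. \<theta> s \<omega> = x s)}
        = ?H \<inter> {\<omega>\<in>space M. \<theta> (Suc t) \<omega> = r}"
        by auto
      ultimately show ?thesis
        using pos by (simp add: cond_prob_def field_simps)
    qed
    have "prob (?H \<inter> {\<omega>\<in>space M. \<theta> (Suc t) \<omega> \<in> R})
      = prob (\<Union>r\<in>R. ?H \<inter> {\<omega>\<in>space M. \<theta> (Suc t) \<omega> = r})"
      by (rule arg_cong[where f = prob]) auto
    also have "\<dots> = (\<Sum>r\<in>R. prob (?H \<inter> {\<omega>\<in>space M. \<theta> (Suc t) \<omega> = r}))"
    proof (rule finite_measure_finite_Union[OF fin(2)])
      show "(\<lambda>r. ?H \<inter> {\<omega>\<in>space M. \<theta> (Suc t) \<omega> = r}) ` R \<subseteq> events"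
        using R by (intro image_subsetI sets.Int[OF Hev] at) blast
      show "disjoint_family_on (\<lambda>r. ?H \<inter> {\<omega>\<in>space M. \<theta> (Suc t) \<omega> = r}) R"
        unfolding disjoint_family_on_def by blast
    qed
    also have "\<dots> = (\<Sum>r\<in>R. p (x t) r t) * prob ?H"
      by (simp add: step sum_distrib_right)
    also have "\<dots> \<le> c * prob ?H"
      using le by (intro mult_right_mono) auto
    finally show ?thesis
      unfolding H .
  qed
qed

text \<open>The output process need not be Markov, so the integral is split over histories of the
  hidden states, of which the past outputs are a function. On each history
  \<open>markov_chain_step\<close> applies, and the nonnegative weight \<open>f\<close> preserves
  the inequality.\<close>

lemma (in prob_space) hmm_output_step:
  fixes f :: "(nat \<Rightarrow> nat) \<Rightarrow> real"
  assumes hmm: "hmm_output M F \<Theta> h \<theta>0 p \<theta> l" and filt: "prob_filtration M F"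
    and le: "\<And>q t. q \<in> \<Theta> \<Longrightarrow> (\<Sum>r\<in>{r\<in>\<Theta>. h r = 1}. p q r t) \<le> c"
    and f: "\<And>y. 0 \<le> f y"
  shows "(\<integral>\<omega>. f (\<lambda>s\<in>{..t}. l s \<omega>) * indicator {\<omega>\<in>space M. l (Suc t) \<omega> = 1} \<omega> \<partial>M)
    \<le> c * (\<integral>\<omega>. f (\<lambda>s\<in>{..t}. l s \<omega>) \<partial>M)"
proof -
  have mc: "markov_chain M F \<Theta> \<theta>0 p \<theta>" and lh: "\<And>t \<omega>. \<omega> \<in> space M \<Longrightarrow> l t \<omega> = h (\<theta> t \<omega>)"
    using hmm by (auto simp: hmm_output_def)
  have fin: "finite \<Theta>"
    using mc by (simp add: markov_chain_def)
  have meas: "\<theta> s \<in> M \<rightarrow>\<^sub>M count_space \<Theta>" for s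
    using mc unfolding markov_chain_def by (blast intro: prob_filtration_measurable[OF filt])
  let ?X = "\<lambda>\<omega>. \<lambda>s\<in>{..t}. \<theta> s \<omega>"
  let ?R = "{r\<in>\<Theta>. h r = 1}"
  let ?E = "{\<omega>\<in>space M. \<theta> (Suc t) \<omega> \<in> ?R}"
  let ?g = "\<lambda>x. f (\<lambda>s\<in>{..t}. h (x s))"
  have X: "?X \<in> M \<rightarrow>\<^sub>M count_space ({..t} \<rightarrow>\<^sub>E \<Theta>)"
    using fin meas by (intro measurable_restrict_count_space_PiE) auto
  have finP: "finite ({..t} \<rightarrow>\<^sub>E \<Theta>)"
    using fin by (intro finite_PiE) auto
  have E: "?E \<in> events"
  proof -
    have "\<theta> (Suc t) -` ?R \<inter> space M \<in> events"
      by (intro measurable_sets[OF meas]) auto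
    then show ?thesis
      by (simp add: vimage_def Int_def conj_commute)
  qed
  have fX: "f (\<lambda>s\<in>{..t}. l s \<omega>) = ?g (?X \<omega>)" if "\<omega> \<in> space M" for \<omega>
    using that by (intro arg_cong[where f = f]) (auto simp: lh)
  have "\<theta> (Suc t) \<omega> \<in> \<Theta>" if "\<omega> \<in> space M" for \<omega>
    using measurable_space[OF meas that] by simp
  then have lE: "{\<omega>\<in>space M. l (Suc t) \<omega> = 1} = ?E"
    by (auto simp: lh)
  have "(\<integral>\<omega>. f (\<lambda>s\<in>{..t}. l s \<omega>) * indicator {\<omega>\<in>space M. l (Suc t) \<omega> = 1} \<omega> \<partial>M)
    = (\<integral>\<omega>. ?g (?X \<omega>) * indicator ?E \<omega> \<partial>M)"
    unfolding lE by (intro Bochner_Integration.integral_cong refl) (simp only: fX)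
  also have "\<dots> = (\<Sum>x\<in>{..t} \<rightarrow>\<^sub>E \<Theta>. ?g x * prob ({\<omega>\<in>space M. ?X \<omega> = x} \<inter> ?E))"
    by (rule integral_finite_range[OF finP X E])
  also have "\<dots> \<le> (\<Sum>x\<in>{..t} \<rightarrow>\<^sub>E \<Theta>. ?g x * (c * prob {\<omega>\<in>space M. ?X \<omega> = x}))"
    using f by (intro sum_mono mult_left_mono markov_chain_step[OF mc filt] le) auto
  \<comment> \<open>Intersecting with \<open>space M\<close> allows
    \<open>integral_finite_range\<close> to be used backwards.\<close>
  also have "\<dots> = c * (\<Sum>x\<in>{..t} \<rightarrow>\<^sub>E \<Theta>. ?g x * prob ({\<omega>\<in>space M. ?X \<omega> = x} \<inter> space M))"
    by (simp add: sum_distrib_left mult_ac Int_absorb2)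
  also have "\<dots> = c * (\<integral>\<omega>. ?g (?X \<omega>) * indicator (space M) \<omega> \<partial>M)"
    by (subst integral_finite_range[OF finP X]) auto
  also have "\<dots> = c * (\<integral>\<omega>. f (\<lambda>s\<in>{..t}. l s \<omega>) \<partial>M)"
    by (intro arg_cong[where f = "(*) c"] Bochner_Integration.integral_cong refl) (simp add: fX)
  finally show ?thesis .
qed

section \<open>Exponential moments and tails along a fixed second path\<close>

lemma binary_process_range:
  assumes "binary_process M l" and "\<omega> \<in> space M"
  shows "l t \<omega> \<in> {0, 1}"
  using assms measurable_space[of "l t" M "count_space {0, 1}" \<omega>] by (simp add: binary_process_def)

lemma binary_process_measurable_UNIV:
  "binary_process M l \<Longrightarrow> l t \<in> M \<rightarrow>\<^sub>M count_space UNIV"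
  unfolding binary_process_def using measurable_count_space_mono[of "l t" M "{0, 1}" UNIV] by blast

lemma exp_le_quadratic:
  fixes x :: real
  assumes "0 \<le> x" and "x \<le> 1"
  shows "exp x \<le> 1 + (x + x\<^sup>2)"
  using exp_bound[OF assms] by simp

lemma (in prob_space) hmm_output_exp_moment:
  fixes v :: "nat \<Rightarrow> nat" and c u :: real
  assumes hmm: "hmm_output M F \<Theta> h \<theta>0 p \<theta> l" and filt: "prob_filtration M F"
    and le: "\<And>q t. q \<in> \<Theta> \<Longrightarrow> (\<Sum>r\<in>{r\<in>\<Theta>. h r = 1}. p q r t) \<le> c"
    and v: "\<And>t. v t \<in> {0, 1}" and u: "0 \<le> u" "u \<le> 1" and c: "0 \<le> c"
  \<comment> \<open>the extra summand \<open>1\<close> pays for time \<open>0\<close>, where the initial distribution is unconstrained\<close>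
  shows "(\<integral>\<omega>. exp (u * (\<Sum>t<k. real (l t \<omega> OR v t))) \<partial>M)
    \<le> exp ((u + u\<^sup>2) * (1 + (\<Sum>t<k. c + (1 - c) * real (v t))))"
proof -
  \<comment> \<open>An output one multiplies the weight by \<open>exp u\<close>. The bound
    \<open>exp u - 1 \<le> b\<close> handles a random one, and \<open>u \<le> b\<close> a certain
    one.\<close>
  define b where "b = u + u\<^sup>2"
  have b: "0 \<le> b" "u \<le> b" "exp u \<le> 1 + b"
    using u exp_le_quadratic[of u] by (auto simp: b_def)
  have bin: "binary_process M l"
    using hmm by (simp add: hmm_output_def)
  have rng: "l t \<omega> \<in> {0, 1}" if "\<omega> \<in> space M" for t \<omega>
    using binary_process_range[OF bin that] .
  have lm[measurable]: "l t \<in> M \<rightarrow>\<^sub>M count_space UNIV" for t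
    using binary_process_measurable_UNIV[OF bin] .
  define W where "W = (\<lambda>k \<omega>. exp (u * (\<Sum>t<k. real (l t \<omega> OR v t))))"
  have Wm[measurable]: "W k \<in> borel_measurable M" for k
    unfolding W_def by measurable
  have Wb: "W k \<omega> \<le> exp (u * real k)" if "\<omega> \<in> space M" for k \<omega>
  proof -
    have "real (l t \<omega> OR v t) \<le> 1" for t
      using rng[OF that, of t] v[of t] by auto
    then have "(\<Sum>t<k. real (l t \<omega> OR v t)) \<le> (\<Sum>t<k. 1)"
      by (intro sum_mono)
    then show ?thesis
      using u by (simp add: W_def mult_left_mono)
  qed
  have Wi: "integrable M (\<lambda>\<omega>. W k \<omega> * indicator A \<omega>)" if "A \<in> events" for k A
  proof (rule integrable_const_bound[where B = "exp (u * real k)"])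
    show "AE \<omega> in M. norm (W k \<omega> * indicator A \<omega>) \<le> exp (u * real k)"
      using Wb[of _ k] by (intro AE_I2) (auto simp: indicator_def W_def)
  qed (use that in measurable)
  have Wi': "integrable M (W k)" for k
  proof (rule integrable_const_bound[where B = "exp (u * real k)"])
    show "AE \<omega> in M. norm (W k \<omega>) \<le> exp (u * real k)"
      using Wb[of _ k] by (intro AE_I2) (auto simp: W_def)
  qed measurable
  have Wn: "0 \<le> expectation (W k)" for k
    by (intro Bochner_Integration.integral_nonneg) (simp add: W_def)
  have vn: "0 \<le> c + (1 - c) * real (v t)" for t
    using v[of t] c by auto
  \<comment> \<open>The history up to time \<open>t\<close> controls the output at time
    \<open>Suc t\<close>, so the recursion starts at \<open>W 1\<close>, with one output already
    counted.\<close>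
  have step: "expectation (W (Suc (Suc t)))
    \<le> expectation (W (Suc t)) * exp (b * (c + (1 - c) * real (v (Suc t))))" for t
  proof (cases "v (Suc t) = 0")
    case True
    let ?E = "{\<omega>\<in>space M. l (Suc t) \<omega> = 1}"
    have E: "?E \<in> events"
      by measurable
    \<comment> \<open>With \<open>v (Suc t) = 0\<close> the new summand is the output of the chain,
      so the weight gains the factor \<open>exp u\<close> exactly on \<open>?E\<close>.\<close>
    have "W (Suc (Suc t)) \<omega> = W (Suc t) \<omega> + (exp u - 1) * (W (Suc t) \<omega> * indicator ?E \<omega>)"
      if "\<omega> \<in> space M" for \<omega>
      using rng[OF that, of "Suc t"] True that
      by (auto simp: W_def distrib_left exp_add algebra_simps)
    then have "expectation (W (Suc (Suc t)))
      = (\<integral>\<omega>. W (Suc t) \<omega> + (exp u - 1) * (W (Suc t) \<omega> * indicator ?E \<omega>) \<partial>M)"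
      by (intro Bochner_Integration.integral_cong) auto
    also have "\<dots> = expectation (W (Suc t)) + (exp u - 1) * (\<integral>\<omega>. W (Suc t) \<omega> * indicator ?E \<omega> \<partial>M)"
      using Wi'[of "Suc t"] Wi[OF E, of "Suc t"] by simp
    also have "\<dots> \<le> expectation (W (Suc t)) + b * (c * expectation (W (Suc t)))"
    proof -
      \<comment> \<open>Exhibits the weight as a function of the restricted output history, the form
        that \<open>hmm_output_step\<close> requires.\<close>
      have W_hist: "W (Suc t) \<omega> = exp (u * (\<Sum>s<Suc t. real ((\<lambda>s\<in>{..t}. l s \<omega>) s OR v s)))" for \<omega>
        unfolding W_def by (auto intro!: sum.cong)
      have "(\<integral>\<omega>. W (Suc t) \<omega> * indicator ?E \<omega> \<partial>M) \<le> c * expectation (W (Suc t))"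
        unfolding W_hist
        by (rule hmm_output_step[OF hmm filt le,
              where f = "\<lambda>y. exp (u * (\<Sum>s<Suc t. real (y s OR v s)))"]) auto
      moreover have "0 \<le> (\<integral>\<omega>. W (Suc t) \<omega> * indicator ?E \<omega> \<partial>M)"
        by (intro Bochner_Integration.integral_nonneg) (simp add: W_def)
      ultimately show ?thesis
        using b u by (intro add_left_mono mult_mono) auto
    qed
    also have "\<dots> = expectation (W (Suc t)) * (1 + b * c)"
      by (simp add: algebra_simps)
    \<comment> \<open>Passing from \<open>1 + b * c\<close> to an exponential turns the product of
      the step factors into a sum in the exponent.\<close>
    also have "\<dots> \<le> expectation (W (Suc t)) * exp (b * c)"
      using Wn by (intro mult_left_mono exp_ge_add_one_self)
    finally show ?thesis
      using True by simp
  next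
    case False
    then have v1: "v (Suc t) = 1"
      using v[of "Suc t"] by auto
    \<comment> \<open>Here the OR equals one surely, matching \<open>c + (1 - c) * 1 = 1\<close> in
      the exponent.\<close>
    have "expectation (W (Suc (Suc t))) = (\<integral>\<omega>. W (Suc t) \<omega> * exp u \<partial>M)"
    proof (rule Bochner_Integration.integral_cong[OF refl])
      fix \<omega> assume "\<omega> \<in> space M"
      then show "W (Suc (Suc t)) \<omega> = W (Suc t) \<omega> * exp u"
        using rng[of \<omega> "Suc t"] v1 by (auto simp: W_def distrib_left exp_add)
    qed
    also have "\<dots> = expectation (W (Suc t)) * exp u"
      by simp
    also have "\<dots> \<le> expectation (W (Suc t)) * exp b"
      using b Wn by (intro mult_left_mono) auto
    finally show ?thesis
      using v1 by simp
  qed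
  have "expectation (W (Suc t)) \<le> exp (b * (1 + (\<Sum>s<Suc t. c + (1 - c) * real (v s))))" for t
  proof (induction t)
    case 0
    have "expectation (W (Suc 0)) \<le> (\<integral>\<omega>. exp u \<partial>M)"
      using Wb[of _ "Suc 0"] by (intro integral_mono Wi') auto
    also have "\<dots> \<le> exp (b * (1 + (c + (1 - c) * real (v 0))))"
    proof -
      have "b * 1 \<le> b * (1 + (c + (1 - c) * real (v 0)))"
        using b vn[of 0] by (intro mult_left_mono) auto
      then show ?thesis
        using b by (simp add: prob_space)
    qed
    finally show ?case
      by simp
  next
    case (Suc t)
    have "expectation (W (Suc (Suc t)))
      \<le> exp (b * (1 + (\<Sum>s<Suc t. c + (1 - c) * real (v s))))
        * exp (b * (c + (1 - c) * real (v (Suc t))))"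
      using Suc by (intro order.trans[OF step] mult_right_mono) auto
    also have "\<dots> = exp (b * (1 + (\<Sum>s<Suc (Suc t). c + (1 - c) * real (v s))))"
      by (simp add: exp_add[symmetric] distrib_left add.assoc)
    finally show ?case .
  qed
  \<comment> \<open>The induction covers \<open>k \<ge> 1\<close>; the empty sum is
    separate.\<close>
  moreover have "expectation (W 0) \<le> exp b"
    using b by (simp add: W_def prob_space)
  ultimately have "expectation (W k) \<le> exp (b * (1 + (\<Sum>s<k. c + (1 - c) * real (v s))))"
    by (cases k) auto
  then show ?thesis
    by (simp add: W_def b_def)
qed

text \<open>Chernoff's bound: Markov's inequality is applied to the exponential moment. The factor
  \<open>exp 2\<close> absorbs the part of the exponent that does not grow with \<open>k\<close>;
  the rest is at most \<open>k * (u * m + u\<^sup>2 - u * \<rho>')\<close>.\<close>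

lemma (in prob_space) hmm_output_tail:
  fixes v :: "nat \<Rightarrow> nat" and c \<rho> \<rho>' :: real
  assumes hmm: "hmm_output M F \<Theta> h \<theta>0 p \<theta> l" and filt: "prob_filtration M F"
    and le: "\<And>q t. q \<in> \<Theta> \<Longrightarrow> (\<Sum>r\<in>{r\<in>\<Theta>. h r = 1}. p q r t) \<le> c"
    and v: "\<And>t. v t \<in> {0, 1}" and v_le: "real (\<Sum>t<k. v t) \<le> \<rho> * real k"
    and c: "c \<in> {0..1}" and \<rho>: "\<rho> \<in> {0..1}" and \<rho>': "c + (1 - c) * \<rho> < \<rho>'" "\<rho>' \<le> 1"
  shows "\<P>(\<omega> in M. real (\<Sum>t<k. l t \<omega> OR v t) > \<rho>' * real k)
    \<le> exp 2 * exp (- (\<rho>' - (c + (1 - c) * \<rho>))\<^sup>2 / 4) ^ k"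
proof -
  define m where "m = c + (1 - c) * \<rho>"
  \<comment> \<open>This choice minimises \<open>u * m + u\<^sup>2 - u * \<rho>'\<close>, with value
    \<open>- (\<rho>' - m)\<^sup>2 / 4\<close>.\<close>
  define u where "u = (\<rho>' - m) / 2"
  have m: "0 \<le> m" "m < \<rho>'"
    using c \<rho> \<rho>' by (auto simp: m_def)
  then have u: "0 < u" "u \<le> 1"
    using \<rho>' by (auto simp: u_def)
  have bin: "binary_process M l"
    using hmm by (simp add: hmm_output_def)
  have lm[measurable]: "l t \<in> M \<rightarrow>\<^sub>M count_space UNIV" for t
    using binary_process_measurable_UNIV[OF bin] .
  have rng: "l t \<omega> \<in> {0, 1}" if "\<omega> \<in> space M" for t \<omega>
    using binary_process_range[OF bin that] .
  let ?S = "\<lambda>\<omega>. \<Sum>t<k. real (l t \<omega> OR v t)"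
  have int: "integrable M (\<lambda>\<omega>. exp (u * ?S \<omega>))"
  proof (rule integrable_const_bound[where B = "exp (u * real k)"])
    have "?S \<omega> \<le> real k" if "\<omega> \<in> space M" for \<omega>
    proof -
      have "real (l t \<omega> OR v t) \<le> 1" for t
        using rng[OF that, of t] v[of t] by auto
      then have "?S \<omega> \<le> (\<Sum>t<k. 1)"
        by (intro sum_mono)
      then show ?thesis
        by simp
    qed
    then show "AE \<omega> in M. norm (exp (u * ?S \<omega>)) \<le> exp (u * real k)"
      using u by (intro AE_I2) auto
  qed measurable
  have "\<P>(\<omega> in M. real (\<Sum>t<k. l t \<omega> OR v t) > \<rho>' * real k)
    \<le> \<P>(\<omega> in M. exp (u * ?S \<omega>) \<ge> exp (u * (\<rho>' * real k)))"
    using u by (intro finite_measure_mono) auto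
  also have "\<dots> \<le> expectation (\<lambda>\<omega>. exp (u * ?S \<omega>)) / exp (u * (\<rho>' * real k))"
    by (rule integral_Markov_inequality_measure[OF int, where A = "{}"]) auto
  also have "\<dots> \<le> exp ((u + u\<^sup>2) * (1 + (\<Sum>t<k. c + (1 - c) * real (v t)))) / exp (u * (\<rho>' * real k))"
    using u c by (intro divide_right_mono hmm_output_exp_moment[OF hmm filt le v]) auto
  also have "\<dots> = exp ((u + u\<^sup>2) * (1 + (\<Sum>t<k. c + (1 - c) * real (v t))) - u * (\<rho>' * real k))"
    by (simp add: exp_diff)
  also have "\<dots> \<le> exp (2 + real k * (- (\<rho>' - m)\<^sup>2 / 4))"
  proof -
    \<comment> \<open>Since \<open>1 - c \<ge> 0\<close>, the bound on the number of ones of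
      \<open>v\<close> makes the exponent grow with slope at most \<open>m\<close>.\<close>
    have "(\<Sum>t<k. c + (1 - c) * real (v t)) = c * real k + (1 - c) * real (\<Sum>t<k. v t)"
      by (simp add: sum.distrib sum_distrib_left)
    also have "\<dots> \<le> c * real k + (1 - c) * (\<rho> * real k)"
      using c v_le by (intro add_left_mono mult_left_mono) auto
    also have "\<dots> = m * real k"
      by (simp add: m_def algebra_simps)
    finally have "(u + u\<^sup>2) * (1 + (\<Sum>t<k. c + (1 - c) * real (v t))) \<le> (u + u\<^sup>2) * (1 + m * real k)"
      using u by (intro mult_left_mono) auto
    moreover have "u + u\<^sup>2 \<le> 2"
      using u power_le_one[of u 2] by simp
    \<comment> \<open>Dropping \<open>m \<le> 1\<close> here leaves an exponent whose minimiser is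
      the chosen \<open>u\<close>.\<close>
    moreover have "real k * (u\<^sup>2 * m) \<le> real k * (u\<^sup>2 * 1)"
      using m \<rho>' by (intro mult_left_mono) auto
    moreover have "real k * (u * m + u\<^sup>2 - u * \<rho>') = real k * (- (\<rho>' - m)\<^sup>2 / 4)"
      by (simp add: u_def power2_eq_square field_simps)
    ultimately show ?thesis
      by (simp add: algebra_simps)
  qed
  also have "\<dots> = exp 2 * exp (- (\<rho>' - m)\<^sup>2 / 4) ^ k"
    by (simp only: exp_add exp_of_nat_mult)
  finally show ?thesis
    by (simp add: m_def)
qed

section \<open>Averaging over the paths of the second process\<close>

text \<open>Only the first \<open>k\<close> values of \<open>l2\<close> matter, so the event splits
  over finitely many prefixes. By independence each prefix contributes at most \<open>C\<close>
  times its own probability, and the prefix events are disjoint.\<close>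

lemma (in prob_space) indep_binary_processes_prob_le:
  fixes Q :: "(nat \<Rightarrow> nat) \<Rightarrow> bool"
  assumes indep: "indep_binary_processes M l1 l2"
    and b1: "binary_process M l1" and b2: "binary_process M l2" and C: "0 \<le> C"
    and Q: "\<And>v w. (\<And>t. t < k \<Longrightarrow> v t = w t) \<Longrightarrow> Q v = Q w"
    and le: "\<And>v. (\<And>t. v t \<in> {0, 1}) \<Longrightarrow> Q v
      \<Longrightarrow> \<P>(\<omega> in M. real (\<Sum>t<k. l1 t \<omega> OR v t) > a) \<le> C"
  shows "\<P>(\<omega> in M. Q (\<lambda>t. l2 t \<omega>) \<and> real (\<Sum>t<k. l1 t \<omega> OR l2 t \<omega>) > a) \<le> C"
proof -
  let ?N = "\<Pi>\<^sub>M t\<in>(UNIV :: nat set). count_space {0, 1 :: nat}"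
  define V where "V = {v \<in> {..<k} \<rightarrow>\<^sub>E {0, 1}. Q v}"
  define A where "A = (\<lambda>v. {\<omega>\<in>space M. \<forall>t<k. l2 t \<omega> = v t})"
  define B where "B = (\<lambda>v. {\<omega>\<in>space M. real (\<Sum>t<k. l1 t \<omega> OR v t) > a})"
  note [measurable] = binary_process_measurable_UNIV[OF b1] binary_process_measurable_UNIV[OF b2]
  have A: "A v \<in> events" and B: "B v \<in> events" for v
    unfolding A_def B_def by measurable
  have fin: "finite V"
    unfolding V_def by (intro finite_subset[OF _ finite_PiE[of "{..<k}" "\<lambda>_. {0, 1}"]]) auto
  \<comment> \<open>Both events are preimages of measurable sets of paths that depend on finitely
    many coordinates, so independence of the path-valued variables applies.\<close>
  have AB: "prob (A v \<inter> B v) = prob (B v) * prob (A v)" for v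
  proof -
    let ?YA = "{y\<in>space ?N. \<forall>t<k. y t = v t}"
    let ?YB = "{y\<in>space ?N. real (\<Sum>t<k. y t OR v t) > a}"
    have comp: "(\<lambda>y. y t) \<in> ?N \<rightarrow>\<^sub>M count_space UNIV" for t
    proof (rule measurable_count_space_mono)
      show "(\<lambda>y. y t) \<in> ?N \<rightarrow>\<^sub>M count_space {0, 1}"
        by (rule measurable_component_singleton) simp
    qed simp
    \<comment> \<open>Measurability is shown for an abstract family \<open>X\<close> and then
      instantiated with the coordinate projections.\<close>
    have "{y\<in>space N. \<forall>t<k. X t y = v t} \<in> sets N"
      "{y\<in>space N. real (\<Sum>t<k. X t y OR v t) > a} \<in> sets N"
      if [measurable]: "\<And>t. X t \<in> N \<rightarrow>\<^sub>M count_space UNIV"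
      for N :: "(nat \<Rightarrow> nat) measure" and X
      by measurable
    from this[of "\<lambda>t y. y t" ?N, OF comp] have "?YA \<in> sets ?N" "?YB \<in> sets ?N" .
    note * = indep_varD[OF indep[unfolded indep_binary_processes_def] this(2,1)]
    have sp: "(\<lambda>t. l1 t \<omega>) \<in> space ?N" "(\<lambda>t. l2 t \<omega>) \<in> space ?N" if "\<omega> \<in> space M" for \<omega>
      using binary_process_range[OF b1 that] binary_process_range[OF b2 that]
      by (simp_all only: space_PiM space_count_space PiE_UNIV_domain Pi_iff) blast+
    have "(\<lambda>\<omega> t. l2 t \<omega>) -` ?YA \<inter> space M = A v" "(\<lambda>\<omega> t. l1 t \<omega>) -` ?YB \<inter> space M = B v"
      "(\<lambda>\<omega>. (\<lambda>t. l1 t \<omega>, \<lambda>t. l2 t \<omega>)) -` (?YB \<times> ?YA) \<inter> space M = A v \<inter> B v"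
      using sp by (auto simp: A_def B_def)
    with * show ?thesis
      by simp
  qed
  have B_le: "prob (B v) \<le> C" if v: "v \<in> V" for v
  proof -
    \<comment> \<open>A prefix in \<open>V\<close> is \<open>undefined\<close> from time
      \<open>k\<close> on, whereas \<open>le\<close> asks for a binary path at all times. Filling
      with \<open>0\<close> changes neither \<open>B v\<close> nor, by locality,
      \<open>Q\<close>.\<close>
    define w where "w = (\<lambda>t. if t < k then v t else 0)"
    have "B v = {\<omega>\<in>space M. real (\<Sum>t<k. l1 t \<omega> OR w t) > a}"
      unfolding B_def w_def by simp
    moreover have "w t \<in> {0, 1}" for t
      using v PiE_mem[of v "{..<k}" "\<lambda>_. {0, 1}" t] by (auto simp: w_def V_def)
    moreover have "Q w"
      using v Q[of v w] by (simp add: V_def w_def)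
    ultimately show ?thesis
      using le[of w] by simp
  qed
  have "{\<omega>\<in>space M. Q (\<lambda>t. l2 t \<omega>) \<and> real (\<Sum>t<k. l1 t \<omega> OR l2 t \<omega>) > a} \<subseteq> (\<Union>v\<in>V. A v \<inter> B v)"
  proof safe
    fix \<omega> assume \<omega>: "\<omega> \<in> space M" "Q (\<lambda>t. l2 t \<omega>)" "real (\<Sum>t<k. l1 t \<omega> OR l2 t \<omega>) > a"
    define v where "v = (\<lambda>t\<in>{..<k}. l2 t \<omega>)"
    have "Q v"
      using \<omega>(2) Q[of v "\<lambda>t. l2 t \<omega>"] by (simp add: v_def)
    then have "v \<in> V"
      using binary_process_range[OF b2 \<omega>(1)] by (auto simp: V_def v_def)
    moreover have "\<omega> \<in> A v \<inter> B v"
      using \<omega> by (simp add: A_def B_def v_def)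
    ultimately show "\<omega> \<in> (\<Union>v\<in>V. A v \<inter> B v)"
      by blast
  qed
  then have "\<P>(\<omega> in M. Q (\<lambda>t. l2 t \<omega>) \<and> real (\<Sum>t<k. l1 t \<omega> OR l2 t \<omega>) > a)
    \<le> prob (\<Union>v\<in>V. A v \<inter> B v)"
    using fin A B by (intro finite_measure_mono) auto
  also have "\<dots> \<le> (\<Sum>v\<in>V. prob (A v \<inter> B v))"
    using fin A B by (intro finite_measure_subadditive_finite) auto
  also have "\<dots> \<le> (\<Sum>v\<in>V. C * prob (A v))"
    unfolding AB using B_le by (intro sum_mono mult_right_mono) auto
  also have "\<dots> = C * prob (\<Union>v\<in>V. A v)"
  proof -
    \<comment> \<open>Prefixes that agree with the same path of \<open>l2\<close> before time
      \<open>k\<close> coincide, being extensional.\<close>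
    have "v = w" if "v \<in> V" "w \<in> V" "\<omega> \<in> A v" "\<omega> \<in> A w" for v w \<omega>
      using that by (intro PiE_ext[of v "{..<k}" "\<lambda>_. {0, 1}" w]) (auto simp: V_def A_def)
    then have "disjoint_family_on A V"
      by (auto simp: disjoint_family_on_def)
    then show ?thesis
      using fin A by (subst finite_measure_finite_Union) (auto simp: sum_distrib_left)
  qed
  also have "\<dots> \<le> C"
    using C by (simp add: mult_left_le)
  finally show ?thesis .
qed

section \<open>Summability of the tails of the combined process\<close>

theorem theorem4p3:
  fixes M :: "'a measure" and F :: "nat \<Rightarrow> 'a measure"
    and l1 l2 :: "nat \<Rightarrow> 'a \<Rightarrow> nat" and p0 p1 \<rho> :: real
  assumes "prob_space M" and "prob_filtration M F"
    and "p0 \<in> {0..1}" and "p1 \<in> {0..1}" and "\<rho> \<in> {0..1}"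
    and "binary_process M l1" and "binary_process M l2"
    and "indep_binary_processes M l1 l2"
    and "l1 \<in> Gamma_processes TYPE('s) M F p0 p1"
    and "l2 \<in> Lambda_processes M \<rho>"
    and "p1 + p0 * \<rho> < 1"
  shows "\<forall>\<rho>'\<in>{p1 + p0 * \<rho><..1}. (\<lambda>t \<omega>. l1 t \<omega> OR l2 t \<omega>) \<in> Lambda_processes M \<rho>'"
proof
  fix \<rho>' assume \<rho>': "\<rho>' \<in> {p1 + p0 * \<rho><..1}"
  interpret prob_space M
    by fact
  obtain \<Theta> :: "'s set" and h \<theta>0 p \<theta> where hmm: "hmm_output M F \<Theta> h \<theta>0 p \<theta> l1"
    and le: "\<And>q t. q \<in> \<Theta> \<Longrightarrow> (\<Sum>r\<in>{r\<in>\<Theta>. h r = 0}. p q r t) \<le> p0"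
            "\<And>q t. q \<in> \<Theta> \<Longrightarrow> (\<Sum>r\<in>{r\<in>\<Theta>. h r = 1}. p q r t) \<le> p1"
    using assms(9) unfolding Gamma_processes_def by blast
  note b1 = \<open>binary_process M l1\<close> and b2 = \<open>binary_process M l2\<close>
  note [measurable] = binary_process_measurable_UNIV[OF b1] binary_process_measurable_UNIV[OF b2]
  have bin: "binary_process M (\<lambda>t \<omega>. l1 t \<omega> OR l2 t \<omega>)"
    unfolding binary_process_def
  proof
    fix t
    have "l1 t \<omega> OR l2 t \<omega> \<in> {0, 1}" if "\<omega> \<in> space M" for \<omega>
      using binary_process_range[OF b1 that, of t] binary_process_range[OF b2 that, of t] by auto
    then show "(\<lambda>\<omega>. l1 t \<omega> OR l2 t \<omega>) \<in> M \<rightarrow>\<^sub>M count_space {0, 1}"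
      by (intro measurable_count_space_extend[of "{0, 1}" UNIV]) auto
  qed
  have "1 \<le> p0 + p1"
  proof -
    have mc: "finite \<Theta>" "(\<Sum>q\<in>\<Theta>. \<theta>0 q) = 1" "\<And>q t. q \<in> \<Theta> \<Longrightarrow> (\<Sum>r\<in>\<Theta>. p q r t) = 1"
      and h: "h \<in> \<Theta> \<rightarrow> {0, 1}"
      using hmm by (auto simp: hmm_output_def markov_chain_def)
    \<comment> \<open>The initial weights sum to \<open>1\<close>, so there is a state whose row of
      transition probabilities can be evaluated.\<close>
    obtain q where q: "q \<in> \<Theta>"
      using mc(2) by fastforce
    have "\<Theta> = {r\<in>\<Theta>. h r = 0} \<union> {r\<in>\<Theta>. h r = 1}"
      using h by auto
    then have "(\<Sum>r\<in>\<Theta>. p q r 0)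
      = (\<Sum>r\<in>{r\<in>\<Theta>. h r = 0}. p q r 0) + (\<Sum>r\<in>{r\<in>\<Theta>. h r = 1}. p q r 0)"
      using mc(1) sum.union_disjoint[of "{r\<in>\<Theta>. h r = 0}" "{r\<in>\<Theta>. h r = 1}" "\<lambda>r. p q r 0"]
      by fastforce
    then show ?thesis
      using mc(3)[OF q, of 0] le[OF q, of 0] by linarith
  qed
  then have "(1 - p1) * \<rho> \<le> p0 * \<rho>"
    using assms(5) by (intro mult_right_mono) auto
  then have gap: "p1 + (1 - p1) * \<rho> < \<rho>'" "\<rho>' \<le> 1"
    using \<rho>' by auto
  define r where "r = exp (- (\<rho>' - (p1 + (1 - p1) * \<rho>))\<^sup>2 / 4)"
  have r: "0 < r" "r < 1"
    using gap by (auto simp: r_def)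
  have "(\<lambda>k. \<P>(\<omega> in M. real (\<Sum>t<k. l1 t \<omega> OR l2 t \<omega>) > \<rho>' * real k)) summable_on {1..}"
  \<comment> \<open>The dominating series adds the tails of \<open>l2\<close>, summable by
    assumption, to a geometric series with ratio \<open>r < 1\<close>.\<close>
  proof (rule summable_on_comparison_test)
    have "(\<lambda>k. r ^ k) summable_on UNIV"
      using r by (intro norm_summable_imp_summable_on) (simp add: summable_geometric)
    then have "(\<lambda>k. exp 2 * r ^ k) summable_on {1..}"
      by (intro summable_on_cmult_right) (rule summable_on_subset_banach, auto)
    then show "(\<lambda>k. \<P>(\<omega> in M. real (\<Sum>t<k. l2 t \<omega>) > \<rho> * real k) + exp 2 * r ^ k) summable_on {1..}"
      using assms(10) unfolding Lambda_processes_def by (intro summable_on_add) auto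
  next
    fix k :: nat
    let ?Q = "\<lambda>v. real (\<Sum>t<k. v t) \<le> \<rho> * real k"
    \<comment> \<open>Splits according to whether \<open>l2\<close> has more than
      \<open>\<rho> * k\<close> ones before time \<open>k\<close>; otherwise its path meets the
      hypothesis of \<open>hmm_output_tail\<close>.\<close>
    have "\<P>(\<omega> in M. real (\<Sum>t<k. l1 t \<omega> OR l2 t \<omega>) > \<rho>' * real k)
      \<le> prob ({\<omega>\<in>space M. real (\<Sum>t<k. l2 t \<omega>) > \<rho> * real k}
        \<union> {\<omega>\<in>space M. ?Q (\<lambda>t. l2 t \<omega>) \<and> real (\<Sum>t<k. l1 t \<omega> OR l2 t \<omega>) > \<rho>' * real k})"
      by (intro finite_measure_mono) auto
    also have "\<dots> \<le> \<P>(\<omega> in M. real (\<Sum>t<k. l2 t \<omega>) > \<rho> * real k)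
      + \<P>(\<omega> in M. ?Q (\<lambda>t. l2 t \<omega>) \<and> real (\<Sum>t<k. l1 t \<omega> OR l2 t \<omega>) > \<rho>' * real k)"
      by (intro measure_Un_le) auto
    also have "\<P>(\<omega> in M. ?Q (\<lambda>t. l2 t \<omega>) \<and> real (\<Sum>t<k. l1 t \<omega> OR l2 t \<omega>) > \<rho>' * real k)
      \<le> exp 2 * r ^ k"
    proof (rule indep_binary_processes_prob_le[OF assms(8) b1 b2, where Q = ?Q])
      show "?Q v = ?Q w" if "\<And>t. t < k \<Longrightarrow> v t = w t" for v w
        using that by simp
      show "\<P>(\<omega> in M. real (\<Sum>t<k. l1 t \<omega> OR v t) > \<rho>' * real k) \<le> exp 2 * r ^ k"
        if "\<And>t. v t \<in> {0, 1}" "?Q v" for v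
        unfolding r_def
        by (rule hmm_output_tail[OF hmm assms(2) le(2) that assms(4,5) gap])
    qed (use r in auto)
    finally show "\<P>(\<omega> in M. real (\<Sum>t<k. l1 t \<omega> OR l2 t \<omega>) > \<rho>' * real k)
      \<le> \<P>(\<omega> in M. real (\<Sum>t<k. l2 t \<omega>) > \<rho> * real k) + exp 2 * r ^ k"
      by simp
  qed simp
  with bin show "(\<lambda>t \<omega>. l1 t \<omega> OR l2 t \<omega>) \<in> Lambda_processes M \<rho>'"
    by (simp add: Lambda_processes_def)
qed

end
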